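(* Let $G$ be a cubic graph on $n\geq 6$ vertices containing a diamond-factor. Then the graph $G$ is $\mathcal{D}$, i.e. Dominator wins the Maker--Breaker total domination game on $G$, no matter which player moves first.
   Context: Graphs are finite and simple; a cubic graph is a $3$-regular graph. The Maker--Breaker total domination (MBTD) game on a graph $G$: two players, Dominator and Staller, alternately claim one previously unclaimed vertex of $G$ per move. Staller wins if at some point she has claimed all vertices of the open neighbourhood $N_G(v)$ of some vertex $v$ of $G$; otherwise Dominator wins (equivalently, Dominator wins if he claims a total dominating set of $G$, i.e. a set $D$ such that every vertex of $G$ has a neighbour in $D$). A graph is $\mathcal{D}$ if Dominator has a winning strategy regardless of who moves first. A diamond is the complete graph on four vertices minus one edge. For a fixed graph $H$ on $h$ vertices, a graph $G$ on $n=x\cdot h$ vertices contains an $H$-factor if it contains $x$ vertex-disjoint copies of $H$. *)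

theory Defs
  imports "Graph_Theory.Graph_Theory"
begin

text \<open>
  A finite simple graph is a \<^locale>\<open>pair_graph\<close>: a finite vertex set with a symmetric and
  irreflexive arc relation, so an undirected edge is a pair of opposite arcs. The degree of a
  vertex is therefore its out-degree.
\<close>

definition cubic :: "'a pair_pre_digraph \<Rightarrow> bool" where
  "cubic G \<longleftrightarrow> pair_graph G \<and> (\<forall>v \<in> pverts G. out_degree G v = 3)"

definition open_neighbourhood :: "'a pair_pre_digraph \<Rightarrow> 'a \<Rightarrow> 'a set" where
  "open_neighbourhood G v = {u. v \<rightarrow>\<^bsub>G\<^esub> u}"


section \<open>Factors\<close>

text \<open>A copy of \<open>H\<close> in \<open>G\<close> is a subgraph of \<open>G\<close>, not necessarily induced, isomorphic to \<open>H\<close>.\<close>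

definition copy_in :: "'b pair_pre_digraph \<Rightarrow> 'a pair_pre_digraph \<Rightarrow> 'a pair_pre_digraph \<Rightarrow> bool" where
  "copy_in H G K \<longleftrightarrow> subgraph K G \<and> digraph_iso H K"

definition has_factor :: "'b pair_pre_digraph \<Rightarrow> 'a pair_pre_digraph \<Rightarrow> bool" where
  "has_factor H G \<longleftrightarrow>
     (\<exists>\<K>. finite \<K> \<and> (\<forall>K \<in> \<K>. copy_in H G K) \<and>
          (\<forall>K \<in> \<K>. \<forall>L \<in> \<K>. K \<noteq> L \<longrightarrow> pverts K \<inter> pverts L = {}) \<and>
          card (pverts G) = card \<K> * card (pverts H))"

definition diamond :: "nat pair_pre_digraph" where
  "diamond = \<lparr> pverts = {0, 1, 2, 3},
     parcs = {0, 1, 2, 3} \<times> {0, 1, 2, 3} - Id - {(2, 3), (3, 2)} \<rparr>"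


section \<open>The Maker--Breaker total domination game\<close>

datatype player = Dominator | Staller

fun opponent :: "player \<Rightarrow> player" where
  "opponent Dominator = Staller"
| "opponent Staller = Dominator"

text \<open>
  The course of a game is recorded as the list of claimed vertices, in the order in which they
  were claimed. Moves are numbered from 0, and the argument \<open>p\<close> is the player who moves first.
\<close>

definition mover :: "player \<Rightarrow> nat \<Rightarrow> player" where
  "mover p i = (if even i then p else opponent p)"

definition is_play :: "'a pair_pre_digraph \<Rightarrow> 'a list \<Rightarrow> bool" where
  "is_play G h \<longleftrightarrow> distinct h \<and> set h \<subseteq> pverts G"

definition claimed :: "player \<Rightarrow> player \<Rightarrow> 'a list \<Rightarrow> 'a set" where
  "claimed p q h = {h ! i | i. i < length h \<and> mover p i = q}"

definition staller_has_won :: "'a pair_pre_digraph \<Rightarrow> player \<Rightarrow> 'a list \<Rightarrow> bool" where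
  "staller_has_won G p h \<longleftrightarrow>
     (\<exists>v \<in> pverts G. open_neighbourhood G v \<subseteq> claimed p Staller h)"

text \<open>A strategy maps the course of the game so far to the vertex to be claimed next.\<close>

definition dominator_follows :: "player \<Rightarrow> ('a list \<Rightarrow> 'a) \<Rightarrow> 'a list \<Rightarrow> bool" where
  "dominator_follows p \<sigma> h \<longleftrightarrow>
     (\<forall>i < length h. mover p i = Dominator \<longrightarrow> h ! i = \<sigma> (take i h))"

text \<open>
  A winning strategy must always supply a legal move while unclaimed vertices remain (otherwise a
  strategy proposing illegal moves would win vacuously), and Staller must not have won at any
  stage of any play against it. Plays \<open>h\<close> range over all stages of the game, not only over those
  in which all vertices are claimed. Whether the players continue after Staller has won is
  immaterial.
\<close>

definition dominator_winning_strategy ::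
    "'a pair_pre_digraph \<Rightarrow> player \<Rightarrow> ('a list \<Rightarrow> 'a) \<Rightarrow> bool" where
  "dominator_winning_strategy G p \<sigma> \<longleftrightarrow>
     (\<forall>h. is_play G h \<and> dominator_follows p \<sigma> h \<longrightarrow>
          \<not> staller_has_won G p h \<and>
          (mover p (length h) = Dominator \<and> set h \<noteq> pverts G \<longrightarrow> \<sigma> h \<in> pverts G - set h))"

definition is_D :: "'a pair_pre_digraph \<Rightarrow> bool" where
  "is_D G \<longleftrightarrow> (\<forall>p. \<exists>\<sigma>. dominator_winning_strategy G p \<sigma>)"

end

theory Submission
  imports Defs
begin

text \<open>
  Dominator wins by a pairing strategy. Partition each diamond of the factor into the pair of its
  two central vertices, of degree three in the diamond, and the pair of its two tips. A central
  vertex is adjacent to both tips, and a tip is adjacent to both central vertices, so the open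
  neighbourhood of every vertex that lies in a diamond contains one of the two pairs of that
  diamond. Since the diamonds of a factor cover all vertices (\<open>factor_covers\<close>), every open
  neighbourhood of \<open>G\<close> contains a pair.

  The pairs are disjoint. So Dominator can answer each move of Staller inside a pair by claiming
  the other vertex of that pair, if it is still free, and thereby prevents Staller from ever owning
  both vertices of a pair, let alone a whole open neighbourhood (\<open>pairing_is_D\<close>). When there is
  nothing to answer, in particular on the opening move, he claims an arbitrary free vertex; this
  cannot harm him.
\<close>


section \<open>Pairing strategies\<close>

definition pairing_reply :: "'a set set \<Rightarrow> 'a set \<Rightarrow> 'a list \<Rightarrow> 'a" where
  "pairing_reply \<P> V h =
     (if h \<noteq> [] \<and> (\<exists>y \<in> V - set h. {last h, y} \<in> \<P>)
      then SOME y. y \<in> V - set h \<and> {last h, y} \<in> \<P>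
      else SOME y. y \<in> V - set h)"

lemma pairing_reply_legal:
  assumes "set h \<subset> V"
  shows "pairing_reply \<P> V h \<in> V - set h"
proof (cases "h \<noteq> [] \<and> (\<exists>y \<in> V - set h. {last h, y} \<in> \<P>)")
  case True
  then have "\<exists>y. y \<in> V - set h \<and> {last h, y} \<in> \<P>" by blast
  from someI_ex[OF this] show ?thesis using True by (simp add: pairing_reply_def)
next
  case False
  have "\<exists>y. y \<in> V - set h" using assms by blast
  from someI_ex[OF this] show ?thesis using False by (auto simp: pairing_reply_def)
qed

text \<open>
  Disjointness makes the answer unique: the vertex claimed last lies in one pair only.
\<close>

lemma pairing_reply_completes:
  assumes disj: "pairwise disjnt \<P>"
    and "h \<noteq> []" "{last h, y} \<in> \<P>" "y \<in> V - set h"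
  shows "pairing_reply \<P> V h = y"
proof -
  have ex: "\<exists>z. z \<in> V - set h \<and> {last h, z} \<in> \<P>" using assms by blast
  have "pairing_reply \<P> V h = (SOME z. z \<in> V - set h \<and> {last h, z} \<in> \<P>)"
    using assms by (auto simp: pairing_reply_def)
  with someI_ex[OF ex]
  have r: "pairing_reply \<P> V h \<notin> set h" "{last h, pairing_reply \<P> V h} \<in> \<P>" by auto
  have "{last h, pairing_reply \<P> V h} = {last h, y}"
    using disj r(2) assms(3) unfolding pairwise_def disjnt_def by (metis disjoint_iff insertI1)
  then show ?thesis using r(1) assms(2,4) by (auto simp: doubleton_eq_iff)
qed

lemma pairing_splits_pairs:
  assumes disj: "pairwise disjnt \<P>"
    and two: "\<And>P. P \<in> \<P> \<Longrightarrow> card P = 2"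
    and play: "is_play G h"
    and follows: "dominator_follows p (pairing_reply \<P> (pverts G)) h"
    and P: "P \<in> \<P>"
  shows "\<not> P \<subseteq> claimed p Staller h"
proof
  assume sub: "P \<subseteq> claimed p Staller h"
  have dist: "distinct h" and hV: "set h \<subseteq> pverts G" using play by (auto simp: is_play_def)
  (* The moves alternate, so Dominator moves strictly between two moves of Staller. Directly after
     her first vertex of a pair the second one is still free, and he takes it himself. *)
  have no_later: False
    if ij: "i < j" "j < length h" "mover p i = Staller" "mover p j = Staller"
      and mem: "{h ! i, h ! j} \<in> \<P>" for i j
  proof -
    have "j \<noteq> Suc i" using ij(3,4) by (cases p) (auto simp: mover_def split: if_splits)
    with ij(1) have lt: "Suc i < j" by simp
    have "mover p (Suc i) = Dominator"
      using ij(3) by (cases p) (auto simp: mover_def split: if_splits)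
    then have move: "h ! Suc i = pairing_reply \<P> (pverts G) (take (Suc i) h)"
      using follows lt ij(2) by (auto simp: dominator_follows_def)
    have "h ! j \<notin> set (take (Suc i) h)"
      using dist ij(2) lt by (auto simp: in_set_conv_nth nth_eq_iff_index_eq)
    moreover have "h ! j \<in> pverts G" using hV ij(2) by auto
    moreover have "last (take (Suc i) h) = h ! i" "take (Suc i) h \<noteq> []"
      using ij(1,2) by (auto simp: take_Suc_conv_app_nth)
    ultimately have "h ! Suc i = h ! j"
      using pairing_reply_completes[OF disj, of "take (Suc i) h" "h ! j"] mem move by auto
    then show False using dist lt ij(2) by (auto simp: nth_eq_iff_index_eq)
  qed
  obtain x y where xy: "P = {x, y}" "x \<noteq> y" using two[OF P] by (auto simp: card_2_iff)
  obtain i j where i: "x = h ! i" "i < length h" "mover p i = Staller"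
    and j: "y = h ! j" "j < length h" "mover p j = Staller"
    using sub xy(1) by (auto simp: claimed_def)
  consider "i < j" | "j < i" using i(1) j(1) xy(2) by (metis linorder_cases)
  then show False
    using no_later[of i j] no_later[of j i] i j P xy(1) by cases (auto simp: insert_commute)
qed

text \<open>
  The strategy never refers to the player who began, so it serves for both orders of play.
\<close>

lemma pairing_is_D:
  assumes "pairwise disjnt \<P>" and "\<And>P. P \<in> \<P> \<Longrightarrow> card P = 2"
    and nbh: "\<And>v. v \<in> pverts G \<Longrightarrow> \<exists>P \<in> \<P>. P \<subseteq> open_neighbourhood G v"
  shows "is_D G"
  unfolding is_D_def dominator_winning_strategy_def
proof (intro allI exI impI conjI)
  fix p h
  assume h: "is_play G h \<and> dominator_follows p (pairing_reply \<P> (pverts G)) h"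
  show "\<not> staller_has_won G p h"
    using pairing_splits_pairs[OF assms(1,2)] h nbh unfolding staller_has_won_def
    by (meson subset_trans)
  assume "mover p (length h) = Dominator \<and> set h \<noteq> pverts G"
  then show "pairing_reply \<P> (pverts G) h \<in> pverts G - set h"
    using h by (intro pairing_reply_legal) (auto simp: is_play_def)
qed


section \<open>Factors and diamonds\<close>

lemma copy_in_embedding:
  assumes "copy_in H G K"
  obtains f where "inj_on f (pverts H)" "pverts K = f ` pverts H"
    "\<And>u v. (u, v) \<in> parcs H \<Longrightarrow> f u \<rightarrow>\<^bsub>G\<^esub> f v"
proof -
  obtain g where iso: "pre_digraph.digraph_isomorphism (with_proj H) g"
    and K: "with_proj K = app_iso g (with_proj H)"
    using assms by (auto simp: copy_in_def digraph_iso_def)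
  have sub: "parcs K \<subseteq> parcs G" using assms by (auto simp: copy_in_def subgraph_def)
  have verts: "pverts K = iso_verts g ` pverts H"
    and arcs: "parcs K = iso_arcs g ` parcs H"
    and ends: "iso_tail g = fst" "iso_head g = snd"
    using arg_cong[OF K, of verts] arg_cong[OF K, of arcs]
      arg_cong[OF K, of tail] arg_cong[OF K, of head] by simp_all
  show thesis
  proof
    show "inj_on (iso_verts g) (pverts H)"
      using iso by (simp add: pre_digraph.digraph_isomorphism_def)
    show "pverts K = iso_verts g ` pverts H" by (fact verts)
    fix u v assume uv: "(u, v) \<in> parcs H"
    then have "iso_arcs g (u, v) = (iso_verts g u, iso_verts g v)"
      using iso ends by (auto simp: pre_digraph.digraph_isomorphism_def prod_eq_iff)
    then show "iso_verts g u \<rightarrow>\<^bsub>G\<^esub> iso_verts g v" using uv arcs sub by force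
  qed
qed

text \<open>
  The copies are disjoint and all have as many vertices as \<open>H\<close>, so the count in the definition of a
  factor leaves no vertex of \<open>G\<close> outside them.
\<close>

lemma factor_covers:
  assumes fin: "finite (pverts G)" and "finite \<K>"
    and copies: "\<And>K. K \<in> \<K> \<Longrightarrow> copy_in H G K"
    and disj: "\<And>K L. K \<in> \<K> \<Longrightarrow> L \<in> \<K> \<Longrightarrow> K \<noteq> L \<Longrightarrow> pverts K \<inter> pverts L = {}"
    and card: "card (pverts G) = card \<K> * card (pverts H)"
  shows "(\<Union>K \<in> \<K>. pverts K) = pverts G"
proof (rule card_subset_eq[OF fin])
  have sub: "pverts K \<subseteq> pverts G" if "K \<in> \<K>" for K
    using copies[OF that] by (auto simp: copy_in_def subgraph_def)
  then show "(\<Union>K \<in> \<K>. pverts K) \<subseteq> pverts G" by blast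
  have "card (\<Union>K \<in> \<K>. pverts K) = (\<Sum>K \<in> \<K>. card (pverts K))"
  proof (rule card_UN_disjoint)
    show "finite \<K>" by (fact assms(2))
    show "\<forall>K \<in> \<K>. finite (pverts K)" using sub fin by (intro ballI) (rule finite_subset)
    show "\<forall>K \<in> \<K>. \<forall>L \<in> \<K>. K \<noteq> L \<longrightarrow> pverts K \<inter> pverts L = {}" using disj by simp
  qed
  also have "\<dots> = (\<Sum>K \<in> \<K>. card (pverts H))"
  proof (rule sum.cong[OF refl])
    fix K assume "K \<in> \<K>"
    then obtain f where "inj_on f (pverts H)" "pverts K = f ` pverts H"
      by (rule copy_in_embedding[OF copies])
    then show "card (pverts K) = card (pverts H)" by (simp add: card_image)
  qed
  finally show "card (\<Union>K \<in> \<K>. pverts K) = card (pverts G)" using card by simp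
qed

text \<open>
  Here \<open>A\<close> consists of the two central vertices of the diamond and \<open>B\<close> of its two tips: each
  vertex of one pair is joined to both vertices of the other.
\<close>

lemma diamond_pairs:
  assumes "copy_in diamond G K"
  shows "\<exists>A B. A \<inter> B = {} \<and> card A = 2 \<and> card B = 2 \<and> A \<subseteq> pverts K \<and> B \<subseteq> pverts K \<and>
    (\<forall>v \<in> pverts K. A \<subseteq> open_neighbourhood G v \<or> B \<subseteq> open_neighbourhood G v)"
proof -
  obtain f where inj: "inj_on f (pverts diamond)" and K: "pverts K = f ` pverts diamond"
    and adj: "\<And>u v. (u, v) \<in> parcs diamond \<Longrightarrow> f u \<rightarrow>\<^bsub>G\<^esub> f v"
    using copy_in_embedding[OF assms] by blast
  have "{f 0, f 1} \<inter> {f 2, f 3} = {}" "card {f 0, f 1} = 2" "card {f 2, f 3} = 2"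
    "{f 0, f 1} \<subseteq> pverts K" "{f 2, f 3} \<subseteq> pverts K"
    using inj K by (auto simp: diamond_def inj_on_def)
  moreover have "{f 0, f 1} \<subseteq> open_neighbourhood G v \<or> {f 2, f 3} \<subseteq> open_neighbourhood G v"
    if "v \<in> pverts K" for v
  proof -
    have central: "{f 2, f 3} \<subseteq> open_neighbourhood G (f i)" if "i \<in> {0, 1}" for i
      using that adj[of i 2] adj[of i 3] by (auto simp: diamond_def open_neighbourhood_def)
    have tip: "{f 0, f 1} \<subseteq> open_neighbourhood G (f i)" if "i \<in> {2, 3}" for i
      using that adj[of i 0] adj[of i 1] by (auto simp: diamond_def open_neighbourhood_def)
    have "v \<in> f ` ({0, 1} \<union> {2, 3})" using that by (auto simp: K diamond_def)
    then show ?thesis using central tip by blast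
  qed
  ultimately show ?thesis by (intro exI[of _ "{f 0, f 1}"] exI[of _ "{f 2, f 3}"] conjI ballI)
qed


section \<open>Cubic graphs with a diamond-factor\<close>

theorem theorem1p1:
  fixes G :: "'a pair_pre_digraph"
  assumes "cubic G"
    and "card (pverts G) \<ge> 6"
    and "has_factor diamond G"
  shows "is_D G"
proof -
  have fin: "finite (pverts G)"
    using assms(1) unfolding cubic_def
    by (intro pair_fin_digraph.pair_finite_verts pair_digraph.axioms(1) pair_graph.axioms(1)) simp
  obtain \<K> where factor: "finite \<K> \<and> (\<forall>K \<in> \<K>. copy_in diamond G K) \<and>
      (\<forall>K \<in> \<K>. \<forall>L \<in> \<K>. K \<noteq> L \<longrightarrow> pverts K \<inter> pverts L = {}) \<and>
      card (pverts G) = card \<K> * card (pverts diamond)"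
    using assms(3) unfolding has_factor_def by (rule exE)
  have disj: "pverts K \<inter> pverts L = {}" if "K \<in> \<K>" "L \<in> \<K>" "K \<noteq> L" for K L
    using factor that by simp
  have cover: "(\<Union>K \<in> \<K>. pverts K) = pverts G"
    using factor by (intro factor_covers[OF fin, of \<K> diamond]) simp_all
  let ?pairs = "\<lambda>K A B. A \<inter> B = {} \<and> card A = 2 \<and> card B = 2 \<and>
      A \<subseteq> pverts K \<and> B \<subseteq> pverts K \<and>
      (\<forall>v \<in> pverts K. A \<subseteq> open_neighbourhood G v \<or> B \<subseteq> open_neighbourhood G v)"
  have "\<forall>K \<in> \<K>. \<exists>A B. ?pairs K A B"
    using factor by (intro ballI diamond_pairs) simp
  from bchoice[OF this] obtain A where "\<forall>K \<in> \<K>. \<exists>B. ?pairs K (A K) B" by (rule exE)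
  from bchoice[OF this] obtain B where AB: "\<forall>K \<in> \<K>. ?pairs K (A K) (B K)" by (rule exE)
  show ?thesis
  proof (rule pairing_is_D)
    have apart: "A K \<inter> A L = {}" "A K \<inter> B L = {}" "B K \<inter> A L = {}" "B K \<inter> B L = {}"
      if "K \<in> \<K>" "L \<in> \<K>" "K \<noteq> L" for K L
    proof -
      have "A K \<union> B K \<subseteq> pverts K" "A L \<union> B L \<subseteq> pverts L" using AB that by simp_all
      then show "A K \<inter> A L = {}" "A K \<inter> B L = {}" "B K \<inter> A L = {}" "B K \<inter> B L = {}"
        using disj[OF that] by blast+
    qed
    show "pairwise disjnt (A ` \<K> \<union> B ` \<K>)"
    proof (rule pairwiseI)
      fix P Q assume "P \<in> A ` \<K> \<union> B ` \<K>" "Q \<in> A ` \<K> \<union> B ` \<K>" "P \<noteq> Q"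
      then obtain K L where KL: "K \<in> \<K>" "L \<in> \<K>" "P = A K \<or> P = B K" "Q = A L \<or> Q = B L"
        by blast
      show "disjnt P Q"
      proof (cases "K = L")
        case True
        have "A K \<inter> B K = {}" using AB KL(1) by simp
        then show ?thesis using KL(3,4) True \<open>P \<noteq> Q\<close> by (auto simp: disjnt_def)
      next
        case False
        then show ?thesis using KL(3,4) apart[OF KL(1,2)] by (auto simp: disjnt_def)
      qed
    qed
    show "card P = 2" if "P \<in> A ` \<K> \<union> B ` \<K>" for P using that AB by auto
    show "\<exists>P \<in> A ` \<K> \<union> B ` \<K>. P \<subseteq> open_neighbourhood G v" if v: "v \<in> pverts G" for v
    proof -
      obtain K where "K \<in> \<K>" "v \<in> pverts K"
        using v unfolding cover[symmetric] by blast
      then have "A K \<subseteq> open_neighbourhood G v \<or> B K \<subseteq> open_neighbourhood G v"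
        using AB by simp
      then show ?thesis using \<open>K \<in> \<K>\<close> by blast
    qed
  qed
qed

end
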